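(* The group of linear fractional transformations modulo proportionality has a subgroup isomorphic to $S_4$, the symmetric group on four elements.
   Context: Let $L$ be the group of quadruples $(a,b,c,d)\in\mathbb{C}^4$ with $ad-bc\neq 0$ under the composition $(a,b,c,d)\circ(a',b',c',d')=(aa'+bc',ab'+bd',ca'+dc',cb'+dd')$. Two quadruples are proportional if one is obtained from the other by multiplying all four coefficients by a common nonzero complex number. The group of linear fractional transformations modulo proportionality is the quotient of $L$ by this relation, with the induced multiplication; it is $\operatorname{PGL}(2,\mathbb{C})$ (equivalently $\operatorname{PSL}(2,\mathbb{C})$). *)

theory Defs
  imports Complex_Main "HOL-Algebra.Sym_Groups"
begin

type_synonym quadruple = "complex \<times> complex \<times> complex \<times> complex"

fun quad_det :: "quadruple \<Rightarrow> complex" where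
  "quad_det (a, b, c, d) = a * d - b * c"

fun quad_comp :: "quadruple \<Rightarrow> quadruple \<Rightarrow> quadruple" where
  "quad_comp (a, b, c, d) (a', b', c', d') =
     (a * a' + b * c', a * b' + b * d', c * a' + d * c', c * b' + d * d')"

fun quad_scale :: "complex \<Rightarrow> quadruple \<Rightarrow> quadruple" where
  "quad_scale k (a, b, c, d) = (k * a, k * b, k * c, k * d)"

definition LFT :: "quadruple monoid" where
  "LFT = \<lparr>carrier = {q. quad_det q \<noteq> 0}, mult = quad_comp, one = (1, 0, 0, 1)\<rparr>"

definition proportional :: "(quadruple \<times> quadruple) set" where
  "proportional =
     {(p, q). p \<in> carrier LFT \<and> q \<in> carrier LFT \<and> (\<exists>k. k \<noteq> 0 \<and> q = quad_scale k p)}"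

text \<open>
  The union in the multiplication is the usual library idiom for an operation induced on
  equivalence classes. That it is independent of the representatives is \<open>LFT_mod_mult\<close> below.
\<close>
definition LFT_mod :: "quadruple set monoid" where
  "LFT_mod =
     \<lparr>carrier = carrier LFT // proportional,
      mult = (\<lambda>A B. \<Union>p\<in>A. \<Union>q\<in>B. proportional `` {p \<otimes>\<^bsub>LFT\<^esub> q}),
      one = proportional `` {\<one>\<^bsub>LFT\<^esub>}\<rparr>"

lemma quad_det_comp: "quad_det (quad_comp p q) = quad_det p * quad_det q"
  by (cases p; cases q) (simp add: algebra_simps)

lemma quad_det_scale: "quad_det (quad_scale k p) = k\<^sup>2 * quad_det p"
  by (cases p) (simp add: algebra_simps power2_eq_square)

lemma quad_scale_scale: "quad_scale k (quad_scale l p) = quad_scale (k * l) p"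
  by (cases p) simp

lemma quad_scale_one: "quad_scale 1 p = p"
  by (cases p) simp

lemma quad_comp_scale:
  "quad_comp (quad_scale k p) (quad_scale l q) = quad_scale (k * l) (quad_comp p q)"
  by (cases p; cases q) (simp add: algebra_simps)

lemma group_LFT: "group LFT"
proof (rule groupI)
  fix x y z
  assume "x \<in> carrier LFT" "y \<in> carrier LFT" "z \<in> carrier LFT"
  show "x \<otimes>\<^bsub>LFT\<^esub> y \<otimes>\<^bsub>LFT\<^esub> z = x \<otimes>\<^bsub>LFT\<^esub> (y \<otimes>\<^bsub>LFT\<^esub> z)"
    by (cases x; cases y; cases z) (simp add: LFT_def algebra_simps)
next
  fix x assume x: "x \<in> carrier LFT"
  obtain a b c d where q: "x = (a, b, c, d)" by (cases x)
  define D where "D = a * d - b * c"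
  have D: "D \<noteq> 0" using x by (simp add: q LFT_def D_def)
  let ?y = "quad_scale (inverse D) (d, - b, - c, a)"
  have "?y \<in> carrier LFT"
    using D by (simp only: LFT_def quad_det_scale partial_object.simps mem_Collect_eq)
      (simp add: D_def algebra_simps)
  moreover have "quad_comp ?y x = quad_scale (inverse D) (D, 0, 0, D)"
    by (simp add: q D_def algebra_simps)
  then have "?y \<otimes>\<^bsub>LFT\<^esub> x = \<one>\<^bsub>LFT\<^esub>"
    using D by (simp add: LFT_def)
  ultimately show "\<exists>y\<in>carrier LFT. y \<otimes>\<^bsub>LFT\<^esub> x = \<one>\<^bsub>LFT\<^esub>" by blast
qed (auto simp: LFT_def quad_det_comp)

lemma proportionalI:
  "\<lbrakk>p \<in> carrier LFT; q \<in> carrier LFT; k \<noteq> 0; q = quad_scale k p\<rbrakk> \<Longrightarrow> (p, q) \<in> proportional"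
  unfolding proportional_def by blast

lemma proportionalE:
  assumes "(p, q) \<in> proportional"
  obtains k where "p \<in> carrier LFT" "q \<in> carrier LFT" "k \<noteq> 0" "q = quad_scale k p"
  using assms unfolding proportional_def by blast

lemma equiv_proportional: "equiv (carrier LFT) proportional"
proof (rule equivI)
  show "proportional \<subseteq> carrier LFT \<times> carrier LFT"
    unfolding proportional_def by blast
  show "refl_on (carrier LFT) proportional"
    by (rule refl_onI, rule proportionalI[where k = 1]) (simp_all only: quad_scale_one one_neq_zero not_False_eq_True)
  show "sym proportional"
  proof (rule symI)
    fix p q assume "(p, q) \<in> proportional"
    then obtain k where k: "p \<in> carrier LFT" "q \<in> carrier LFT" "k \<noteq> 0" "q = quad_scale k p"
      by (rule proportionalE)
    have "quad_scale (inverse k) q = p"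
      unfolding k(4) quad_scale_scale using k(3) by (simp add: quad_scale_one)
    with k show "(q, p) \<in> proportional"
      by (intro proportionalI[where k = "inverse k"]) simp_all
  qed
  show "trans proportional"
  proof (rule transI)
    fix p q r assume "(p, q) \<in> proportional" "(q, r) \<in> proportional"
    then obtain k l where "p \<in> carrier LFT" "r \<in> carrier LFT" "k \<noteq> 0" "l \<noteq> 0"
      "q = quad_scale k p" "r = quad_scale l q"
      by (meson proportionalE)
    then show "(p, r) \<in> proportional"
      by (intro proportionalI[where k = "l * k"]) (simp_all add: quad_scale_scale)
  qed
qed

lemma congruent2_LFT_mult:
  "congruent2 proportional proportional (\<lambda>p q. proportional `` {p \<otimes>\<^bsub>LFT\<^esub> q})"
proof (rule congruent2I')
  fix p p' q q'
  assume "(p, p') \<in> proportional" "(q, q') \<in> proportional"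
  then obtain k l where kl: "k \<noteq> 0" "l \<noteq> 0" "p' = quad_scale k p" "q' = quad_scale l q"
    and car: "p \<in> carrier LFT" "p' \<in> carrier LFT" "q \<in> carrier LFT" "q' \<in> carrier LFT"
    by (meson proportionalE)
  interpret group LFT by (rule group_LFT)
  have "p' \<otimes>\<^bsub>LFT\<^esub> q' = quad_scale (k * l) (p \<otimes>\<^bsub>LFT\<^esub> q)"
    by (simp add: kl LFT_def quad_comp_scale)
  moreover have "p \<otimes>\<^bsub>LFT\<^esub> q \<in> carrier LFT" "p' \<otimes>\<^bsub>LFT\<^esub> q' \<in> carrier LFT" "k * l \<noteq> 0"
    using car kl by auto
  ultimately have "(p \<otimes>\<^bsub>LFT\<^esub> q, p' \<otimes>\<^bsub>LFT\<^esub> q') \<in> proportional"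
    by (blast intro: proportionalI)
  then show "proportional `` {p \<otimes>\<^bsub>LFT\<^esub> q} = proportional `` {p' \<otimes>\<^bsub>LFT\<^esub> q'}"
    by (rule equiv_class_eq[OF equiv_proportional])
qed

lemma LFT_mod_mult:
  assumes "p \<in> carrier LFT" "q \<in> carrier LFT"
  shows "(proportional `` {p}) \<otimes>\<^bsub>LFT_mod\<^esub> (proportional `` {q}) =
         proportional `` {p \<otimes>\<^bsub>LFT\<^esub> q}"
  using UN_equiv_class2[OF equiv_proportional equiv_proportional congruent2_LFT_mult assms]
  by (simp add: LFT_mod_def)

lemma group_LFT_mod: "group LFT_mod"
proof -
  interpret L: group LFT by (rule group_LFT)
  have cls: "proportional `` {p} \<in> carrier LFT_mod" if "p \<in> carrier LFT" for p
    using that by (simp add: LFT_mod_def quotientI)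
  have ex: "\<exists>p\<in>carrier LFT. A = proportional `` {p}" if "A \<in> carrier LFT_mod" for A
    using that by (auto simp: LFT_mod_def elim: quotientE)
  have one: "\<one>\<^bsub>LFT_mod\<^esub> = proportional `` {\<one>\<^bsub>LFT\<^esub>}"
    by (simp add: LFT_mod_def)
  show ?thesis
  proof (rule groupI)
    fix A B assume "A \<in> carrier LFT_mod" "B \<in> carrier LFT_mod"
    then show "A \<otimes>\<^bsub>LFT_mod\<^esub> B \<in> carrier LFT_mod"
      by (auto dest!: ex simp: LFT_mod_mult cls)
  next
    show "\<one>\<^bsub>LFT_mod\<^esub> \<in> carrier LFT_mod"
      by (simp add: one cls)
  next
    fix A B C
    assume "A \<in> carrier LFT_mod" "B \<in> carrier LFT_mod" "C \<in> carrier LFT_mod"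
    then show "A \<otimes>\<^bsub>LFT_mod\<^esub> B \<otimes>\<^bsub>LFT_mod\<^esub> C = A \<otimes>\<^bsub>LFT_mod\<^esub> (B \<otimes>\<^bsub>LFT_mod\<^esub> C)"
      by (auto dest!: ex simp: LFT_mod_mult L.m_assoc)
  next
    fix A assume "A \<in> carrier LFT_mod"
    then show "\<one>\<^bsub>LFT_mod\<^esub> \<otimes>\<^bsub>LFT_mod\<^esub> A = A"
      by (auto dest!: ex simp: LFT_mod_mult one)
  next
    fix A assume "A \<in> carrier LFT_mod"
    then obtain p where p: "p \<in> carrier LFT" "A = proportional `` {p}"
      using ex by blast
    then have "proportional `` {inv\<^bsub>LFT\<^esub> p} \<otimes>\<^bsub>LFT_mod\<^esub> A = \<one>\<^bsub>LFT_mod\<^esub>"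
      by (simp add: LFT_mod_mult one)
    then show "\<exists>B\<in>carrier LFT_mod. B \<otimes>\<^bsub>LFT_mod\<^esub> A = \<one>\<^bsub>LFT_mod\<^esub>"
      using p cls by (meson L.inv_closed)
  qed
qed

end

theory Submission
  imports Defs "HOL-Library.Product_Plus"
begin

text \<open>
  Via conjugation on traceless matrices, the half-turns about the four body diagonals of a cube
  are four elements of PGL(2,C) whose common centralizer is trivial. Half-turns about the
  edge axes of the cube transpose two of the diagonals and fix the other two, so every permutation
  of the diagonals is induced by conjugation with exactly one element of PGL(2,C).
\<close>

text \<open>Transpositions generate the symmetric group, so by \<open>transp\<close> every
  permutation of the \<open>V i\<close> is induced by conjugation. By \<open>centralizer\<close> the
  inducing element is unique, which makes the assignment a homomorphism; \<open>inj\<close> makes it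
  injective.\<close>

lemma (in group) sym_group_embeds:
  assumes V: "\<And>i. i \<in> {1..n} \<Longrightarrow> V i \<in> carrier G"
    and inj: "inj_on V {1..n}"
    and centralizer: "\<And>g. \<lbrakk>g \<in> carrier G; \<And>i. i \<in> {1..n} \<Longrightarrow> g \<otimes> V i = V i \<otimes> g\<rbrakk> \<Longrightarrow> g = \<one>"
    and transp: "\<And>i j. \<lbrakk>i \<in> {1..n}; j \<in> {1..n}; i \<noteq> j\<rbrakk> \<Longrightarrow>
      \<exists>g\<in>carrier G. \<forall>k\<in>{1..n}. g \<otimes> V k = V (transpose i j k) \<otimes> g"
  shows "\<exists>H. subgroup H G \<and> G\<lparr>carrier := H\<rparr> \<cong> sym_group n"
proof -
  \<comment> \<open>Conjugation by \<open>g\<close> permutes the \<open>V k\<close> as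
    \<open>p\<close> does, written without inverses.\<close>
  define R where "R g p \<longleftrightarrow> g \<in> carrier G \<and> (\<forall>k\<in>{1..n}. g \<otimes> V k = V (p k) \<otimes> g)" for g p
  have R_mult: "R (g \<otimes> h) (p \<circ> q)"
    if g: "R g p" and h: "R h q" and p: "p permutes {1..n}" and q: "q permutes {1..n}" for g h p q
    unfolding R_def
  proof (intro conjI ballI)
    have gh: "g \<in> carrier G" "h \<in> carrier G" using g h by (auto simp: R_def)
    then show "g \<otimes> h \<in> carrier G" by simp
    fix k assume k: "k \<in> {1..n}"
    have k': "q k \<in> {1..n}" "p (q k) \<in> {1..n}"
      using p q k by (meson permutes_in_image)+
    have "(g \<otimes> h) \<otimes> V k = g \<otimes> (V (q k) \<otimes> h)"
      using h k gh V by (simp add: R_def m_assoc)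
    also have "\<dots> = (V (p (q k)) \<otimes> g) \<otimes> h"
      using g k' gh V by (simp add: R_def flip: m_assoc)
    finally show "(g \<otimes> h) \<otimes> V k = V ((p \<circ> q) k) \<otimes> (g \<otimes> h)"
      using k' gh V by (simp add: m_assoc)
  qed
  have R_ex: "\<exists>g. R g p" if "p permutes {1..n}" for p
    using that finite_atLeastAtMost
  proof (induction p rule: permutes_induct)
    case id
    have "R \<one> id" using V by (simp add: R_def)
    then show ?case ..
  next
    case (swap a b p)
    then obtain h where h: "R h p" by blast
    obtain g where g: "R g (transpose a b)" using transp[of a b] swap unfolding R_def by blast
    from g have "R (g \<otimes> h) (transpose a b \<circ> p)"
      using h swap by (intro R_mult permutes_swap_id)
    then show ?case ..
  qed
  have R_unique: "g = h" if g: "R g p" and h: "R h p" and p: "p permutes {1..n}" for g h p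
  proof -
    have gh: "g \<in> carrier G" "h \<in> carrier G" using g h by (auto simp: R_def)
    \<comment> \<open>Both \<open>g\<close> and \<open>h\<close> conjugate \<open>V k\<close> to
      \<open>V (p k)\<close>, so \<open>inv h \<otimes> g\<close> commutes with every
      \<open>V k\<close>.\<close>
    have "inv h \<otimes> g = \<one>"
    proof (rule centralizer)
      fix k assume k: "k \<in> {1..n}"
      have k': "p k \<in> {1..n}" using p k by (meson permutes_in_image)
      have "h \<otimes> V k = V (p k) \<otimes> h" using h k by (simp add: R_def)
      then have "inv h \<otimes> V (p k) = V k \<otimes> inv h"
        by (metis V gh(2) inv_closed inv_solve_left inv_solve_right k k' m_assoc m_closed)
      then have "inv h \<otimes> V (p k) \<otimes> g = V k \<otimes> inv h \<otimes> g" by simp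
      then show "inv h \<otimes> g \<otimes> V k = V k \<otimes> (inv h \<otimes> g)"
        using g gh k k' V by (simp add: R_def m_assoc)
    qed (use gh in simp)
    then show ?thesis using gh by (metis inv_equality inv_inv inv_closed)
  qed
  define \<psi> where "\<psi> p = (SOME g. R g p)" for p
  have \<psi>: "R (\<psi> p) p" if "p permutes {1..n}" for p
    unfolding \<psi>_def using R_ex[OF that] by (rule someI_ex)
  \<comment> \<open>Both sides of the homomorphism law induce the composite permutation, so
    \<open>R_unique\<close> equates them whatever choices \<open>\<psi>\<close> makes.\<close>
  have hom: "\<psi> \<in> hom (sym_group n) G"
  proof (rule homI)
    fix p q assume "p \<in> carrier (sym_group n)" "q \<in> carrier (sym_group n)"
    then have "p permutes {1..n}" "q permutes {1..n}" by (simp_all add: sym_group_def)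
    then show "\<psi> (p \<otimes>\<^bsub>sym_group n\<^esub> q) = \<psi> p \<otimes> \<psi> q"
      unfolding sym_group_def
      by (simp add: R_unique[OF \<psi> R_mult] \<psi> permutes_compose)
  qed (use \<psi> in \<open>auto simp: sym_group_def R_def\<close>)
  have inj_\<psi>: "inj_on \<psi> (carrier (sym_group n))"
  proof (rule inj_onI)
    fix p q assume "p \<in> carrier (sym_group n)" "q \<in> carrier (sym_group n)" and eq: "\<psi> p = \<psi> q"
    then have p: "p permutes {1..n}" and q: "q permutes {1..n}" by (simp_all add: sym_group_def)
    show "p = q"
    proof
      fix k
      show "p k = q k"
      proof (cases "k \<in> {1..n}")
        case True
        then have k: "p k \<in> {1..n}" "q k \<in> {1..n}"
          using p q by (meson permutes_in_image)+
        have "V (p k) \<otimes> \<psi> p = V (q k) \<otimes> \<psi> p" "\<psi> p \<in> carrier G"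
          using \<psi>[OF p] \<psi>[OF q] True eq by (auto simp: R_def)
        then have "V (p k) = V (q k)" using V k by simp
        then show ?thesis using inj k by (simp add: inj_on_eq_iff)
      next
        case False
        then show ?thesis using p q by (simp add: permutes_not_in)
      qed
    qed
  qed
  interpret \<psi>: group_hom "sym_group n" G \<psi>
    using hom sym_group_is_group is_group by (simp add: group_hom_def group_hom_axioms_def)
  let ?H = "\<psi> ` carrier (sym_group n)"
  have "\<psi> \<in> iso (sym_group n) (G\<lparr>carrier := ?H\<rparr>)"
    using inj_\<psi> hom by (auto simp: iso_def hom_def bij_betw_def)
  then have "G\<lparr>carrier := ?H\<rparr> \<cong> sym_group n"
    by (meson group.iso_sym is_isoI sym_group_is_group)
  with \<psi>.img_is_subgroup show ?thesis by blast
qed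

lemma proportional_class_eq_iff:
  assumes "p \<in> carrier LFT" "q \<in> carrier LFT"
  shows "proportional `` {p} = proportional `` {q} \<longleftrightarrow> (\<exists>k. k \<noteq> 0 \<and> q = quad_scale k p)"
  using eq_equiv_class_iff[OF equiv_proportional assms] assms by (auto simp: proportional_def)

text \<open>
  The traceless matrix \<open>((z, x - \<i>y), (x + \<i>y, -z))\<close>, a combination of Pauli matrices, is the half-turn
  about \<open>(x, y, z)\<close>. The four diagonals are \<open>(1, 1, 1)\<close>, \<open>(1, -1, -1)\<close>, \<open>(-1, 1, -1)\<close>, \<open>(-1, -1, 1)\<close>.
\<close>
definition diagonal :: "nat \<Rightarrow> quadruple" where
  "diagonal i =
     (if i = 1 then (1, 1 - \<i>, 1 + \<i>, -1)
      else if i = 2 then (-1, 1 + \<i>, 1 - \<i>, 1)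
      else if i = 3 then (-1, -1 - \<i>, -1 + \<i>, 1)
      else (1, -1 + \<i>, -1 - \<i>, -1))"

lemma atLeastAtMost_1_4: "{1..4} = {1, 2, 3, 4 :: nat}"
  by auto

lemma diagonal_in_carrier: "diagonal i \<in> carrier LFT"
  by (simp add: LFT_def diagonal_def algebra_simps)

text \<open>The difference is a nonzero real vector along an edge axis, and the determinant of its
  matrix is minus its squared length.\<close>

lemma diagonal_diff_in_carrier:
  assumes "i \<in> {1..4}" "j \<in> {1..4}" "i \<noteq> j"
  shows "diagonal i - diagonal j \<in> carrier LFT"
  using assms unfolding atLeastAtMost_1_4
  by (auto simp: LFT_def diagonal_def complex_eq_iff)

lemma diagonal_not_proportional:
  assumes "i \<in> {1..4}" "j \<in> {1..4}" "diagonal j = quad_scale k (diagonal i)"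
  shows "i = j"
proof -
  \<comment> \<open>Every diagonal has first entry 1 or -1.\<close>
  have "k = 1 \<or> k = -1"
    using assms(3) by (auto simp: diagonal_def minus_equation_iff split: if_splits)
  then show ?thesis
    using assms unfolding atLeastAtMost_1_4 by (auto simp: diagonal_def complex_eq_iff)
qed

text \<open>
  The half-turn about the difference of two diagonals is minus the reflection that swaps these
  two diagonals and fixes the other two, hence the factor -1.
\<close>
lemma diagonal_diff_comp:
  assumes "i \<in> {1..4}" "j \<in> {1..4}" "k \<in> {1..4}" "i \<noteq> j"
  shows "quad_comp (diagonal i - diagonal j) (diagonal k) =
    quad_scale (-1) (quad_comp (diagonal (transpose i j k)) (diagonal i - diagonal j))"
proof -
  have "diagonal (Suc 0) = (1, 1 - \<i>, 1 + \<i>, -1)" "diagonal 2 = (-1, 1 + \<i>, 1 - \<i>, 1)"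
    "diagonal 3 = (-1, -1 - \<i>, -1 + \<i>, 1)" "diagonal 4 = (1, -1 + \<i>, -1 - \<i>, -1)"
    by (simp_all add: diagonal_def)
  then show ?thesis
    using assms unfolding atLeastAtMost_1_4
    by (elim insertE emptyE; hypsubst) (simp_all add: transpose_def complex_eq_iff)
qed

text \<open>
  The four diagonals sum to zero and any three of them are linearly independent, so \<open>g\<close> commutes
  with all of them up to one common factor, and hence with every traceless matrix.
\<close>
lemma centralizer_diagonals_scalar:
  assumes g: "g \<in> carrier LFT"
    and comm: "\<And>i. i \<in> {1..4} \<Longrightarrow>
      quad_comp (diagonal i) g = quad_scale (k i) (quad_comp g (diagonal i))"
  shows "\<exists>c. c \<noteq> 0 \<and> g = quad_scale c (1, 0, 0, 1)"
proof -
  obtain a b c d where q: "g = (a, b, c, d)" by (cases g)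
  have det: "a * d - b * c \<noteq> 0" using g by (simp add: LFT_def q)
  \<comment> \<open>Here \<open>x\<close>, \<open>y\<close>, \<open>z\<close> are entries of the
    matrix of a diagonal, not the coordinates of its axis.\<close>
  have e: "x * a + y * c = l * (a * x + b * z)" "x * b + y * d = l * (a * y - b * x)"
      "z * a - x * c = l * (c * x + d * z)" "z * b - x * d = l * (c * y - d * x)"
    if "i \<in> {1..4}" "diagonal i = (x, y, z, -x)" "l = k i" for i x y z l
    using comm[OF that(1)] that(2,3) by (simp_all add: q)
  define k1 k2 k3 k4 where k_defs: "k1 = k 1" "k2 = k 2" "k3 = k 3" "k4 = k 4"
  have e1: "a + (1 - \<i>) * c = k1 * (a + b * (1 + \<i>))"
      "b + (1 - \<i>) * d = k1 * (a * (1 - \<i>) - b)"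
      "(1 + \<i>) * a - c = k1 * (c + d * (1 + \<i>))"
      "(1 + \<i>) * b - d = k1 * (c * (1 - \<i>) - d)"
    using e[of 1 1 "1 - \<i>" "1 + \<i>" k1] by (simp_all add: diagonal_def k_defs)
  have e2: "(1 + \<i>) * c - a = k2 * (b * (1 - \<i>) - a)"
      "(1 + \<i>) * d - b = k2 * (a * (1 + \<i>) + b)"
      "(1 - \<i>) * a + c = k2 * (d * (1 - \<i>) - c)"
      "(1 - \<i>) * b + d = k2 * (c * (1 + \<i>) + d)"
    using e[of 2 "-1" "1 + \<i>" "1 - \<i>" k2] by (simp_all add: diagonal_def k_defs)
  have e3: "(- 1 - \<i>) * c - a = k3 * (b * (\<i> - 1) - a)"
      "(- 1 - \<i>) * d - b = k3 * (a * (- 1 - \<i>) + b)"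
      "(\<i> - 1) * a + c = k3 * (d * (\<i> - 1) - c)"
      "(\<i> - 1) * b + d = k3 * (c * (- 1 - \<i>) + d)"
    using e[of 3 "-1" "-1 - \<i>" "-1 + \<i>" k3] by (simp_all add: diagonal_def k_defs)
  have e4: "a + (\<i> - 1) * c = k4 * (a + b * (- 1 - \<i>))"
      "b + (\<i> - 1) * d = k4 * (a * (\<i> - 1) - b)"
      "(- 1 - \<i>) * a - c = k4 * (c + d * (- 1 - \<i>))"
      "(- 1 - \<i>) * b - d = k4 * (c * (\<i> - 1) - d)"
    using e[of 4 1 "-1 + \<i>" "-1 - \<i>" k4] by (simp_all add: diagonal_def k_defs)
  \<comment> \<open>\<open>(X, Y, Z)\<close> is the sum of the diagonals weighted by the \<open>k\<close>'s; its matrix is killed by \<open>g\<close>.\<close>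
  define X Y Z where XYZ: "X = k1 + k2 - k3 - k4" "Y = k1 - k2 + k3 - k4" "Z = k1 - k2 - k3 + k4"
  \<comment> \<open>On adding the four relations the left sides cancel, since the diagonals sum to
    zero.\<close>
  have row1: "a * Z + b * (X + \<i> * Y) = 0" "a * (X - \<i> * Y) - b * Z = 0"
    subgoal using e1(1) e2(1) e3(1) e4(1) unfolding XYZ by algebra
    subgoal using e1(2) e2(2) e3(2) e4(2) unfolding XYZ by algebra
    done
  have row2: "c * Z + d * (X + \<i> * Y) = 0" "c * (X - \<i> * Y) - d * Z = 0"
    subgoal using e1(3) e2(3) e3(3) e4(3) unfolding XYZ by algebra
    subgoal using e1(4) e2(4) e3(4) e4(4) unfolding XYZ by algebra
    done
  have "(a * d - b * c) * Z = 0" "(a * d - b * c) * (X + \<i> * Y) = 0"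
    using row1(1) row2(1) by algebra+
  moreover have "(a * d - b * c) * (X - \<i> * Y) = 0"
    using row1(2) row2(2) by algebra
  ultimately have "Z = 0" "X + \<i> * Y = 0" "X - \<i> * Y = 0" using det by simp_all
  then have "X = 0" "Y = 0" "Z = 0" by (simp_all add: complex_eq_iff)
  \<comment> \<open>\<open>X + Y\<close>, \<open>X + Z\<close> and \<open>Y + Z\<close> are twice
    the differences of \<open>k1\<close> with \<open>k4\<close>, \<open>k3\<close> and
    \<open>k2\<close>.\<close>
  then have k_eq: "k2 = k1" "k3 = k1" "k4 = k1"
    unfolding XYZ by algebra+
  \<comment> \<open>Adding the second, third or fourth diagonal to the first gives twice a Pauli
    matrix (x, y, z respectively). With the common factor \<open>k1\<close>, the x and y relations
    force \<open>b = c = 0\<close>, the z relation gives \<open>k1 = 1\<close>, and the x relation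
    then gives \<open>d = a\<close>.\<close>
  have c: "c = k1 * b"
    using e1(1) e2(1) unfolding k_eq by algebra
  have "\<i> * c = \<i> * - (k1 * b)"
    using e1(1) e3(1) unfolding k_eq by algebra
  then have "c = - (k1 * b)" unfolding mult_cancel_left by simp
  then have c0: "c = 0" using c by auto
  have "b = k1 * c"
    using e1(4) e2(4) unfolding k_eq by algebra
  then have b0: "b = 0" using c0 by simp
  have "a = k1 * a"
    using e1(1) e4(1) unfolding k_eq by algebra
  moreover have a0: "a \<noteq> 0" using det c0 by simp
  ultimately have "k1 = 1" by simp
  moreover have "d = k1 * a"
    using e1(2) e2(2) unfolding k_eq by algebra
  ultimately show ?thesis using a0 b0 c0 by (simp add: q)
qed

theorem mainTheorem7:
  shows "\<exists>H. subgroup H LFT_mod \<and> LFT_mod\<lparr>carrier := H\<rparr> \<cong> sym_group 4"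
proof (rule group.sym_group_embeds[OF group_LFT_mod, where V = "\<lambda>i. proportional `` {diagonal i}"])
  interpret L: group LFT by (rule group_LFT)
  show "proportional `` {diagonal i} \<in> carrier LFT_mod" for i
    using diagonal_in_carrier by (simp add: LFT_mod_def quotientI)
  show "inj_on (\<lambda>i. proportional `` {diagonal i}) {1..4}"
    by (intro inj_onI)
      (metis diagonal_in_carrier diagonal_not_proportional proportional_class_eq_iff)
  show "g = \<one>\<^bsub>LFT_mod\<^esub>"
    if "g \<in> carrier LFT_mod"
      and comm: "\<And>i. i \<in> {1..4} \<Longrightarrow> g \<otimes>\<^bsub>LFT_mod\<^esub> proportional `` {diagonal i} =
        proportional `` {diagonal i} \<otimes>\<^bsub>LFT_mod\<^esub> g" for g
  proof -
    from that(1) obtain p where p: "p \<in> carrier LFT" "g = proportional `` {p}"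
      by (auto simp add: LFT_mod_def simp del: split_paired_All elim: quotientE)
    \<comment> \<open>Commuting in the quotient means commuting up to a factor, which may a priori
      depend on \<open>i\<close>.\<close>
    have "\<exists>k. k \<noteq> 0 \<and> quad_comp (diagonal i) p = quad_scale k (quad_comp p (diagonal i))"
      if "i \<in> {1..4}" for i
      using comm[OF that] p diagonal_in_carrier[of i] L.m_closed
      by (simp add: LFT_mod_mult proportional_class_eq_iff) (simp add: LFT_def)
    then obtain k where "\<And>i. i \<in> {1..4} \<Longrightarrow> k i \<noteq> 0 \<and>
        quad_comp (diagonal i) p = quad_scale (k i) (quad_comp p (diagonal i))"
      by metis
    then obtain c where "c \<noteq> 0" "p = quad_scale c (1, 0, 0, 1)"
      using centralizer_diagonals_scalar[OF p(1)] by blast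
    moreover have "\<one>\<^bsub>LFT\<^esub> = (1, 0, 0, 1)" by (simp add: LFT_def)
    ultimately have "proportional `` {\<one>\<^bsub>LFT\<^esub>} = proportional `` {p}"
      using proportional_class_eq_iff p(1) L.one_closed by metis
    then show ?thesis using p by (simp add: LFT_mod_def)
  qed
  show "\<exists>g\<in>carrier LFT_mod. \<forall>k\<in>{1..4}. g \<otimes>\<^bsub>LFT_mod\<^esub> proportional `` {diagonal k} =
      proportional `` {diagonal (transpose i j k)} \<otimes>\<^bsub>LFT_mod\<^esub> g"
    if ij: "i \<in> {1..4}" "j \<in> {1..4}" "i \<noteq> j" for i j
  proof (intro bexI ballI)
    let ?t = "diagonal i - diagonal j"
    have t: "?t \<in> carrier LFT" using diagonal_diff_in_carrier[OF ij] .
    show "proportional `` {?t} \<in> carrier LFT_mod"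
      using t by (simp add: LFT_mod_def quotientI)
    fix k :: nat assume "k \<in> {1..4}"
    then have "?t \<otimes>\<^bsub>LFT\<^esub> diagonal k = quad_scale (-1) (diagonal (transpose i j k) \<otimes>\<^bsub>LFT\<^esub> ?t)"
      using diagonal_diff_comp ij by (simp add: LFT_def)
    \<comment> \<open>The factor -1 disappears in the quotient.\<close>
    then have "proportional `` {diagonal (transpose i j k) \<otimes>\<^bsub>LFT\<^esub> ?t} =
        proportional `` {?t \<otimes>\<^bsub>LFT\<^esub> diagonal k}"
      using t diagonal_in_carrier proportional_class_eq_iff
      by (metis L.m_closed neg_equal_0_iff_equal one_neq_zero)
    then show "proportional `` {?t} \<otimes>\<^bsub>LFT_mod\<^esub> proportional `` {diagonal k} =
        proportional `` {diagonal (transpose i j k)} \<otimes>\<^bsub>LFT_mod\<^esub> proportional `` {?t}"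
      using t diagonal_in_carrier by (simp add: LFT_mod_mult)
  qed
qed

end
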